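(* For every integer $n\geq 1$, the number $|\mathcal{I}_n|$ of intervals in the Tamari lattice $Y_n$ is $$|\mathcal{I}_n|=\frac{2(4n+1)!}{(n+1)!\,(3n+2)!}.$$
   Context: A planar binary tree is a finite connected simply connected plane graph whose vertices have valence $1$ or $3$, with one distinguished vertex of valence $1$, the root; the other vertices of valence $1$ are the leaves and the vertices of valence $3$ are the internal vertices (leaves drawn at the top, root at the bottom). $Y_n$ is the set of planar binary trees with $n$ internal vertices; $|$ denotes the trivial tree with one leaf and no internal vertex. For trees $S,T$ (possibly trivial), $S\vee T$ is the tree whose bottom internal vertex has left subtree $S$ and right subtree $T$. Tamari order on $Y_n$: $S\leq T$ if and only if one can pass from $S$ to $T$ by a (possibly empty) sequence of elementary moves, each consisting in replacing, somewhere inside the tree, a subtree of the form $A\vee(B\vee C)$ by $(A\vee B)\vee C$, where $A,B,C$ are planar binary trees, possibly trivial. $Y_n$ with this partial order is the Tamari lattice. An interval in $Y_n$ is $[S,T]$ given by a pair $S\leq T$ in $Y_n$ (including $S=T$); $\mathcal{I}_n$ is the set of intervals in $Y_n$. *)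

theory Defs
  imports Complex_Main "HOL-Library.Tree"
begin

(* Planar binary trees carry no labels, so they are unit trees: Leaf is the trivial tree, and
   Node constructors are the internal vertices, which is exactly what size counts. *)
type_synonym pbtree = "unit tree"

definition graft :: "pbtree \<Rightarrow> pbtree \<Rightarrow> pbtree" (infixr "\<or>\<^sub>t" 65)
  where "S \<or>\<^sub>t T = Node S () T"

definition Y :: "nat \<Rightarrow> pbtree set"
  where "Y n = {T. size T = n}"

inductive tamari_move :: "pbtree \<Rightarrow> pbtree \<Rightarrow> bool" where
  rotate: "tamari_move (A \<or>\<^sub>t (B \<or>\<^sub>t C)) ((A \<or>\<^sub>t B) \<or>\<^sub>t C)"
| left: "tamari_move S S' \<Longrightarrow> tamari_move (S \<or>\<^sub>t T) (S' \<or>\<^sub>t T)"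
| right: "tamari_move T T' \<Longrightarrow> tamari_move (S \<or>\<^sub>t T) (S \<or>\<^sub>t T')"

definition tamari_le :: "pbtree \<Rightarrow> pbtree \<Rightarrow> bool"  (infix "\<le>\<^sub>t" 50)
  where "S \<le>\<^sub>t T \<longleftrightarrow> tamari_move\<^sup>*\<^sup>* S T"

(* The moves preserve size, so a chain of moves starting in Y n stays in Y n. *)
lemma size_tamari_move: "tamari_move S T \<Longrightarrow> size S = size T"
  by (induction rule: tamari_move.induct) (simp_all add: graft_def)

lemma size_tamari_le: "S \<le>\<^sub>t T \<Longrightarrow> size S = size T"
  unfolding tamari_le_def
  by (induction rule: rtranclp_induct) (simp_all add: size_tamari_move)

(* An interval is represented by its pair of endpoints. *)
definition tamari_intervals :: "nat \<Rightarrow> (pbtree \<times> pbtree) set"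
  where "tamari_intervals n = {(S, T). S \<in> Y n \<and> T \<in> Y n \<and> S \<le>\<^sub>t T}"

end

theory Submission
  imports Defs "HOL-Computational_Algebra.Formal_Power_Series"
begin

text \<open>
  The proof decomposes intervals recursively, turns the decomposition into a functional equation
  with one catalytic variable, and solves that equation by an explicit rational parametrization.

  Let the bottom tree of an interval be \<open>S \<or>\<^sub>t B\<close>. The trees above it are obtained by taking a tree
  \<open>S' \<ge> S\<close> and a tree \<open>W \<ge> B\<close>, cutting the left border of \<open>W\<close> at one of its \<open>l + 1\<close> edges (\<open>l\<close> being
  the number of its nodes) into an upper part \<open>U\<close> and a lower part \<open>V\<close>, and plugging \<open>S' \<or>\<^sub>t U\<close> into
  the leftmost leaf of \<open>V\<close> (\<open>graft_le_iff\<close>). This is bijective, so the generating function \<open>F(t, x)\<close>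
  of intervals, with \<open>t\<close> marking size and \<open>x\<close> the length of the left border of the top tree,
  satisfies
  \<open>F(x) = 1 + x * t * F(x) * (x * F(x) - F(1)) / (x - 1)\<close>.
  The equation determines \<open>F\<close> (\<open>catalytic_system_unique\<close>).

  Put \<open>t = z * (1 - z)^3\<close> and let \<open>A\<close> be the Catalan series at \<open>x * z * (1 - z)\<close>, that is
  \<open>A = 1 + x * z * (1 - z) * A\<^sup>2\<close>. Then \<open>F = (A - z * A\<^sup>2) / (1 - z)\<close> solves the equation
  (\<open>parametrized_identity\<close>, \<open>catalytic_system_param\<close>), and \<open>A = 1 / (1 - z)\<close> at \<open>x = 1\<close> gives
  \<open>F(1) = (1 - 2 * z) / (1 - z)^3\<close> for the series that counts all intervals. Lagrange inversion
  (\<open>fps_lagrange_change_of_variable\<close>) extracts its coefficient at \<open>t ^ n\<close> as a combination of three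
  binomial coefficients, which simplifies to the claimed quotient of factorials.
\<close>

section \<open>Decomposition of Tamari intervals\<close>

lemmas moves = tamari_move.intros[unfolded graft_def]

lemma move_Node_cases:
  assumes "tamari_move (Node L () R) X"
  obtains (rotate) B C where "R = Node B () C" "X = Node (Node L () B) () C"
  | (left) L' where "X = Node L' () R" "tamari_move L L'"
  | (right) R' where "X = Node L () R'" "tamari_move R R'"
  using assms by (cases rule: tamari_move.cases) (auto simp: graft_def)

lemma tamari_refl [simp, intro]: "T \<le>\<^sub>t T"
  by (simp add: tamari_le_def)

lemma tamari_trans [trans]: "S \<le>\<^sub>t T \<Longrightarrow> T \<le>\<^sub>t U \<Longrightarrow> S \<le>\<^sub>t U"
  by (simp add: tamari_le_def)

lemma move_le: "tamari_move S T \<Longrightarrow> S \<le>\<^sub>t T"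
  by (auto simp: tamari_le_def)

lemma tamari_le_left:
  assumes "S \<le>\<^sub>t S'" shows "Node S () T \<le>\<^sub>t Node S' () T"
  using assms unfolding tamari_le_def
  by (induction rule: rtranclp_induct) (auto intro: rtranclp.rtrancl_into_rtrancl moves)

lemma tamari_le_right:
  assumes "T \<le>\<^sub>t T'" shows "Node S () T \<le>\<^sub>t Node S () T'"
  using assms unfolding tamari_le_def
  by (induction rule: rtranclp_induct) (auto intro: rtranclp.rtrancl_into_rtrancl moves)

text \<open>Concatenation of left borders: the first tree is plugged into the leftmost leaf of the second
  one, the operation known as ``over'' on planar binary trees. Listing the right subtrees met
  along the left border identifies trees with lists of trees, and this operation with append; in
  these terms a move either replaces an entry \<open>B \<or>\<^sub>t C\<close> by the two entries \<open>B, C\<close> or acts inside an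
  entry. This is what makes the order decomposable.\<close>

fun over :: "pbtree \<Rightarrow> pbtree \<Rightarrow> pbtree" where
  "over S Leaf = S"
| "over S (Node L u R) = Node (over S L) u R"

fun spine_len :: "pbtree \<Rightarrow> nat" where
  "spine_len Leaf = 0"
| "spine_len (Node L u R) = Suc (spine_len L)"

lemma size_over [simp]: "size (over S T) = size S + size T"
  by (induction T) auto

lemma spine_len_over [simp]: "spine_len (over S T) = spine_len S + spine_len T"
  by (induction T) auto

lemma spine_len_le_size: "spine_len T \<le> size T"
  by (induction T) auto

lemma over_split:
  "v \<le> spine_len W \<Longrightarrow> \<exists>U V. W = over U V \<and> spine_len V = v"
proof (induction W arbitrary: v)
  case Leaf
  then show ?case by (auto intro!: exI[of _ Leaf])
next
  case (Node L u R)
  show ?case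
  proof (cases v)
    case 0
    have "Node L u R = over (Node L u R) Leaf \<and> spine_len Leaf = v"
      using 0 by simp
    then show ?thesis by blast
  next
    case (Suc v')
    then obtain U V where "L = over U V" "spine_len V = v'"
      using Node.IH(1)[of v'] Node.prems by (metis Suc_le_mono spine_len.simps(2))
    then have "Node L u R = over U (Node V u R) \<and> spine_len (Node V u R) = v"
      using Suc by simp
    then show ?thesis by blast
  qed
qed

lemma over_inject:
  "over U V = over U' V' \<Longrightarrow> spine_len V = spine_len V' \<Longrightarrow> U = U' \<and> V = V'"
proof (induction V arbitrary: V')
  case Leaf
  then show ?case by (cases V') auto
next
  case (Node L u R)
  then show ?case by (cases V') auto
qed

text \<open>Cutting the left border of a tree at a node is determined by the size of what lies above the
  cut, since the possible sizes strictly increase down the border.\<close>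

lemma over_graft_inject:
  "over (Node S () U) V = over (Node S' () U') V' \<Longrightarrow> size S = size S'
    \<Longrightarrow> S = S' \<and> U = U' \<and> V = V'"
proof (induction V arbitrary: V')
  case Leaf
  then show ?case by (cases V') auto
next
  case (Node L u R)
  then show ?case by (cases V') auto
qed

lemma graft_over_le: "Node S () (over U V) \<le>\<^sub>t over (Node S () U) V"
proof (induction V)
  case (Node L u R)
  have "Node S () (over U (Node L u R)) \<le>\<^sub>t Node (Node S () (over U L)) () R"
    by (simp add: move_le moves)
  also have "\<dots> \<le>\<^sub>t over (Node S () U) (Node L u R)"
    using Node.IH(1) by (simp add: tamari_le_left)
  finally show ?case .
qed simp

text \<open>The invariant behind the decomposition: the node of \<open>Node S () U\<close> persists on the left border
  under moves. A rotation at this node moves a piece of \<open>U\<close> to the border below it, which leaves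
  \<open>over U V\<close> unchanged; every other move takes place in \<open>S\<close> or is visible in \<open>over U V\<close>.\<close>

lemma move_over_graft:
  "tamari_move (over (Node S () U) V) X \<Longrightarrow>
   \<exists>S' U' V'. X = over (Node S' () U') V' \<and> S \<le>\<^sub>t S' \<and> over U V \<le>\<^sub>t over U' V'"
proof (induction V arbitrary: X)
  case Leaf
  then have "tamari_move (Node S () U) X" by simp
  then show ?case
  proof (cases rule: move_Node_cases)
    case (rotate B C)
    then have "X = over (Node S () B) (Node Leaf () C) \<and> S \<le>\<^sub>t S
        \<and> over U Leaf \<le>\<^sub>t over B (Node Leaf () C)" by simp
    then show ?thesis by blast
  next
    case (left A')
    then have "X = over (Node A' () U) Leaf \<and> S \<le>\<^sub>t A' \<and> over U Leaf \<le>\<^sub>t over U Leaf"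
      by (simp add: move_le)
    then show ?thesis by blast
  next
    case (right B')
    then have "X = over (Node S () B') Leaf \<and> S \<le>\<^sub>t S \<and> over U Leaf \<le>\<^sub>t over B' Leaf"
      by (simp add: move_le)
    then show ?thesis by blast
  qed
next
  case (Node L u R)
  then have "tamari_move (Node (over (Node S () U) L) () R) X" by simp
  then show ?case
  proof (cases rule: move_Node_cases)
    case (rotate B C)
    then have "X = over (Node S () U) (Node (Node L () B) () C) \<and> S \<le>\<^sub>t S
        \<and> over U (Node L u R) \<le>\<^sub>t over U (Node (Node L () B) () C)"
      by (simp add: move_le moves)
    then show ?thesis by blast
  next
    case (left A')
    then obtain S' U' V' where "A' = over (Node S' () U') V'" "S \<le>\<^sub>t S'"
      "over U L \<le>\<^sub>t over U' V'" using Node.IH(1) by blast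
    then have "X = over (Node S' () U') (Node V' () R) \<and> S \<le>\<^sub>t S'
        \<and> over U (Node L u R) \<le>\<^sub>t over U' (Node V' () R)"
      using left by (simp add: tamari_le_left)
    then show ?thesis by blast
  next
    case (right B')
    then have "X = over (Node S () U) (Node L () B') \<and> S \<le>\<^sub>t S
        \<and> over U (Node L u R) \<le>\<^sub>t over U (Node L () B')"
      by (simp add: tamari_le_right move_le)
    then show ?thesis by blast
  qed
qed

text \<open>An interval whose bottom tree has subtrees \<open>S\<close> and \<open>B\<close> amounts to an interval with bottom
  \<open>S\<close>, an interval with bottom \<open>B\<close>, and a place to cut the left border of the top tree of the latter.\<close>

lemma graft_le_iff:
  "Node S () B \<le>\<^sub>t T \<longleftrightarrow>
   (\<exists>S' U V. T = over (Node S' () U) V \<and> S \<le>\<^sub>t S' \<and> B \<le>\<^sub>t over U V)"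
proof
  assume "Node S () B \<le>\<^sub>t T"
  then show "\<exists>S' U V. T = over (Node S' () U) V \<and> S \<le>\<^sub>t S' \<and> B \<le>\<^sub>t over U V"
    unfolding tamari_le_def[of "Node S () B"]
  proof (induction rule: rtranclp_induct)
    case base
    have "Node S () B = over (Node S () B) Leaf \<and> S \<le>\<^sub>t S \<and> B \<le>\<^sub>t over B Leaf" by simp
    then show ?case by blast
  next
    case (step T T')
    then obtain S' U V where T: "T = over (Node S' () U) V" "S \<le>\<^sub>t S'" "B \<le>\<^sub>t over U V"
      by blast
    from step(2) obtain S'' U' V' where "T' = over (Node S'' () U') V'" "S' \<le>\<^sub>t S''"
      "over U V \<le>\<^sub>t over U' V'"
      unfolding T(1) by (blast dest: move_over_graft)
    then show ?case using T(2,3) tamari_trans by blast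
  qed
next
  assume "\<exists>S' U V. T = over (Node S' () U) V \<and> S \<le>\<^sub>t S' \<and> B \<le>\<^sub>t over U V"
  then obtain S' U V where T: "T = over (Node S' () U) V" "S \<le>\<^sub>t S'" "B \<le>\<^sub>t over U V" by blast
  have "Node S () B \<le>\<^sub>t Node S' () B" using T by (simp add: tamari_le_left)
  also have "\<dots> \<le>\<^sub>t Node S' () (over U V)" using T by (simp add: tamari_le_right)
  also have "\<dots> \<le>\<^sub>t T" using T graft_over_le by simp
  finally show "Node S () B \<le>\<^sub>t T" .
qed

definition intervals_spine_eq :: "nat \<Rightarrow> nat \<Rightarrow> (pbtree \<times> pbtree) set" where
  "intervals_spine_eq n k = {(S, T) \<in> tamari_intervals n. spine_len T = k}"

definition intervals_spine_ge :: "nat \<Rightarrow> nat \<Rightarrow> (pbtree \<times> pbtree) set" where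
  "intervals_spine_ge n k = {(S, T) \<in> tamari_intervals n. k \<le> spine_len T}"

lemma finite_trees: "finite {T :: pbtree. size T \<le> n}"
proof (induction n)
  case (Suc n)
  have "{T :: pbtree. size T \<le> Suc n} \<subseteq>
    insert Leaf ((\<lambda>(L, R). Node L () R) ` ({T. size T \<le> n} \<times> {T. size T \<le> n}))"
  proof
    fix T :: pbtree assume "T \<in> {T. size T \<le> Suc n}"
    then show "T \<in> insert Leaf ((\<lambda>(L, R). Node L () R) ` ({T. size T \<le> n} \<times> {T. size T \<le> n}))"
      by (cases T) (auto simp: image_iff)
  qed
  then show ?case using Suc by (simp add: finite_subset)
qed simp

lemma finite_intervals: "finite (tamari_intervals n)"
  by (rule finite_subset[of _ "{T. size T \<le> n} \<times> {T. size T \<le> n}"])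
    (auto simp: tamari_intervals_def Y_def finite_trees)

lemma finite_intervals_spine_eq: "finite (intervals_spine_eq n k)"
  unfolding intervals_spine_eq_def by (rule finite_subset[OF _ finite_intervals]) auto

lemma finite_intervals_spine_ge: "finite (intervals_spine_ge n k)"
  unfolding intervals_spine_ge_def by (rule finite_subset[OF _ finite_intervals]) auto

text \<open>Counting the triples of the lemma \<open>graft_le_iff\<close>. With \<open>T = over (Node S' () U) V\<close> the left border of \<open>T\<close>
  has length \<open>spine_len S' + 1 + spine_len V\<close>, so prescribing this length and \<open>S'\<close> prescribes where
  \<open>W = over U V\<close> has to be cut. The cut exists exactly if the border of \<open>W\<close> is long enough.\<close>

lemma card_intervals_spine_eq_Suc:
  "card (intervals_spine_eq (Suc n) (Suc k)) =
   (\<Sum>i\<le>n. \<Sum>j\<le>k. card (intervals_spine_eq i j) * card (intervals_spine_ge (n - i) (k - j)))"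
proof -
  \<comment> \<open>Both sides are in bijection with the set \<open>M\<close> of intervals above the two subtrees
    together with a cut.\<close>
  define M where "M = {(S, S', B, U, V). S \<le>\<^sub>t S' \<and> B \<le>\<^sub>t over U V
    \<and> size S + size B = n \<and> spine_len S' + spine_len V = k}"
  define f where "f = (\<lambda>(S, S', B, U, V). (Node S () B, over (Node S' () U) V))"
  define g where "g = (\<lambda>(S :: pbtree, S', B :: pbtree, U, V). ((size S, spine_len S'), ((S, S'), (B, over U V))))"
  let ?P = "SIGMA (i, j):{..n} \<times> {..k}. intervals_spine_eq i j \<times> intervals_spine_ge (n - i) (k - j)"
  have f: "bij_betw f M (intervals_spine_eq (Suc n) (Suc k))"
    unfolding bij_betw_def
  proof
    show "inj_on f M"
    proof (rule inj_onI)
      fix x y assume xy: "x \<in> M" "y \<in> M" "f x = f y"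
      obtain S S' B U V where x: "x = (S, S', B, U, V)" by (cases x)
      obtain R R' C U' V' where y: "y = (R, R', C, U', V')" by (cases y)
      have eq: "over (Node S' () U) V = over (Node R' () U') V'" "S = R" "B = C"
        using xy(3) x y by (simp_all add: f_def)
      have "S \<le>\<^sub>t S'" "R \<le>\<^sub>t R'"
        using xy x y by (simp_all add: M_def)
      then have "size S' = size R'"
        using eq(2) size_tamari_le by metis
      then show "x = y" using over_graft_inject[OF eq(1)] eq x y by simp
    qed
    show "f ` M = intervals_spine_eq (Suc n) (Suc k)"
    proof (intro set_eqI iffI)
      fix I assume "I \<in> f ` M"
      then obtain S S' B U V where I: "I = (Node S () B, over (Node S' () U) V)"
        and SB: "S \<le>\<^sub>t S'" "B \<le>\<^sub>t over U V"
        and sizes: "size S + size B = n" "spine_len S' + spine_len V = k"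
        by (auto simp: M_def f_def)
      have "Node S () B \<le>\<^sub>t over (Node S' () U) V"
        unfolding graft_le_iff using SB by blast
      then show "I \<in> intervals_spine_eq (Suc n) (Suc k)"
        using size_tamari_le[OF SB(1)] size_tamari_le[OF SB(2)] sizes
        by (simp add: I intervals_spine_eq_def tamari_intervals_def Y_def)
    next
      fix I assume I: "I \<in> intervals_spine_eq (Suc n) (Suc k)"
      then obtain X T where X: "I = (X, T)" "size X = Suc n" "spine_len T = Suc k" "X \<le>\<^sub>t T"
        by (auto simp: intervals_spine_eq_def tamari_intervals_def Y_def)
      then obtain S B where SB: "X = Node S () B" by (cases X) auto
      then obtain S' U V where "T = over (Node S' () U) V" "S \<le>\<^sub>t S'" "B \<le>\<^sub>t over U V"
        using X(4) unfolding SB graft_le_iff by blast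
      then have "(S, S', B, U, V) \<in> M" "I = f (S, S', B, U, V)"
        using X SB by (auto simp: M_def f_def)
      then show "I \<in> f ` M" by blast
    qed
  qed
  have g: "bij_betw g M ?P"
    unfolding bij_betw_def
  proof
    show "inj_on g M"
    proof (rule inj_onI)
      fix x y assume xy: "x \<in> M" "y \<in> M" "g x = g y"
      obtain S S' B U V where x: "x = (S, S', B, U, V)" by (cases x)
      obtain R R' C U' V' where y: "y = (R, R', C, U', V')" by (cases y)
      have eq: "over U V = over U' V'" "S = R" "S' = R'" "B = C"
        using xy(3) x y by (simp_all add: g_def)
      have "spine_len S' + spine_len V = k" "spine_len R' + spine_len V' = k"
        using xy x y by (simp_all add: M_def)
      then have "spine_len V = spine_len V'" using eq by simp
      then show "x = y" using over_inject[OF eq(1)] eq x y by simp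
    qed
    show "g ` M = ?P"
    proof (intro set_eqI iffI)
      fix I assume "I \<in> g ` M"
      then obtain S S' B U V where I: "I = ((size S, spine_len S'), ((S, S'), (B, over U V)))"
        and SB: "S \<le>\<^sub>t S'" "B \<le>\<^sub>t over U V"
        and sizes: "size S + size B = n" "spine_len S' + spine_len V = k"
        by (auto simp: M_def g_def)
      show "I \<in> ?P"
        using size_tamari_le[OF SB(1)] size_tamari_le[OF SB(2)] SB sizes
        by (auto simp: I intervals_spine_eq_def intervals_spine_ge_def tamari_intervals_def Y_def)
    next
      fix I assume "I \<in> ?P"
      then obtain S S' B W where I: "I = ((size S, spine_len S'), ((S, S'), (B, W)))"
          "S \<le>\<^sub>t S'" "B \<le>\<^sub>t W" "size S + size B = n" "k - spine_len S' \<le> spine_len W" "spine_len S' \<le> k"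
        by (auto simp: intervals_spine_eq_def intervals_spine_ge_def tamari_intervals_def Y_def)
      then obtain U V where "W = over U V" "spine_len V = k - spine_len S'"
        using over_split[OF I(5)] by blast
      then have "(S, S', B, U, V) \<in> M" "I = g (S, S', B, U, V)"
        using I by (auto simp: M_def g_def)
      then show "I \<in> g ` M" by blast
    qed
  qed
  have "card (intervals_spine_eq (Suc n) (Suc k)) = card ?P"
    using bij_betw_same_card[OF f] bij_betw_same_card[OF g] by simp
  also have "\<dots> = (\<Sum>(i, j)\<in>{..n} \<times> {..k}. card (intervals_spine_eq i j \<times> intervals_spine_ge (n - i) (k - j)))"
    by (subst card_SigmaI) (auto simp: finite_intervals_spine_eq finite_intervals_spine_ge case_prod_unfold)
  finally show ?thesis
    by (simp add: card_cartesian_product sum.cartesian_product)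
qed

lemma card_intervals_spine_eq_0_left: "card (intervals_spine_eq 0 k) = (if k = 0 then 1 else 0)"
proof -
  have "intervals_spine_eq 0 k = (if k = 0 then {(Leaf, Leaf)} else {})"
    by (auto simp: intervals_spine_eq_def tamari_intervals_def Y_def)
  then show ?thesis by simp
qed

lemma card_intervals_spine_eq_0_right: "card (intervals_spine_eq (Suc n) 0) = 0"
proof -
  have "spine_len T \<noteq> 0" if "size T = Suc n" for T
    using that by (cases T) auto
  then have "intervals_spine_eq (Suc n) 0 = {}"
    by (auto simp: intervals_spine_eq_def tamari_intervals_def Y_def)
  then show ?thesis by simp
qed

lemma card_intervals_spine_ge_step:
  "card (intervals_spine_ge n k) = card (intervals_spine_eq n k) + card (intervals_spine_ge n (Suc k))"
proof -
  have "intervals_spine_ge n k = intervals_spine_eq n k \<union> intervals_spine_ge n (Suc k)"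
    "intervals_spine_eq n k \<inter> intervals_spine_ge n (Suc k) = {}"
    by (auto simp: intervals_spine_eq_def intervals_spine_ge_def)
  then show ?thesis
    by (simp add: card_Un_disjoint finite_intervals_spine_eq finite_intervals_spine_ge)
qed

lemma card_intervals_spine_ge_large: "n < k \<Longrightarrow> card (intervals_spine_ge n k) = 0"
proof -
  assume "n < k"
  have "spine_len T < k" if "size T = n" for T
    using spine_len_le_size[of T] that \<open>n < k\<close> by simp
  then have "intervals_spine_ge n k = {}"
    by (fastforce simp: intervals_spine_ge_def tamari_intervals_def Y_def)
  then show ?thesis by simp
qed

lemma intervals_spine_ge_0: "intervals_spine_ge n 0 = tamari_intervals n"
  by (auto simp: intervals_spine_ge_def)

section \<open>Lagrange inversion\<close>

text \<open>Lagrange inversion in the form of a change of variables in a residue, without mention of the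
  compositional inverse: the left-hand side is the residue of \<open>g(t) / t^(n + 1)\<close>, and \<open>t\<close> is replaced by
  \<open>z * \<psi>(z)\<close>. By linearity this reduces to powers of \<open>t\<close>, where it holds because
  \<open>t^(-m - 1) * t'\<close> is a derivative for \<open>m \<noteq> 0\<close> and so has no residue.\<close>

lemma fps_lagrange_change_of_variable:
  fixes g \<psi> \<chi> :: "'a :: field_char_0 fps"
  assumes inv: "\<psi> * \<chi> = 1"
  defines "t \<equiv> fps_X * \<psi>"
  shows "fps_nth g n = fps_nth ((g oo t) * fps_deriv t * \<chi> ^ Suc n) n"
proof -
  have d\<chi>: "fps_deriv \<chi> = - fps_deriv \<psi> * \<chi>\<^sup>2"
  proof -
    have "fps_deriv \<psi> * \<chi> + \<psi> * fps_deriv \<chi> = 0"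
      using arg_cong[OF inv, of fps_deriv] by (simp add: add.commute)
    then have "\<chi> * (fps_deriv \<psi> * \<chi> + \<psi> * fps_deriv \<chi>) = 0" by simp
    then have "fps_deriv \<psi> * \<chi>\<^sup>2 + (\<psi> * \<chi>) * fps_deriv \<chi> = 0"
      by (simp add: algebra_simps power2_eq_square)
    then show ?thesis by (simp add: inv eq_neg_iff_add_eq_0 add.commute)
  qed
  have dt: "fps_deriv t = \<psi> + fps_X * fps_deriv \<psi>"
    by (simp add: t_def)
  have key: "fps_nth (fps_deriv t * \<chi> ^ Suc m) m = (if m = 0 then 1 else 0)" for m
  proof (cases m)
    case 0
    then show ?thesis using arg_cong[OF inv, of "\<lambda>f. fps_nth f 0"] by (simp add: dt)
  next
    case (Suc k)
    have "\<psi> * \<chi> ^ Suc m = \<chi> ^ m" using inv by (simp add: mult.assoc[symmetric])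
    then have e: "fps_deriv t * \<chi> ^ Suc m = \<chi> ^ m + fps_X * (fps_deriv \<psi> * \<chi> ^ Suc m)"
      by (simp add: dt algebra_simps)
    have "fps_deriv (\<chi> ^ m) = - of_nat m * (fps_deriv \<psi> * \<chi> ^ Suc m)"
      unfolding fps_deriv_power' d\<chi> Suc by (simp add: power2_eq_square algebra_simps)
    then have "fps_nth (fps_deriv (\<chi> ^ m)) k = - of_nat m * fps_nth (fps_deriv \<psi> * \<chi> ^ Suc m) k"
      by (simp del: power_Suc fps_deriv_power fps_deriv_nth flip: fps_of_nat)
    then have "of_nat m * (fps_nth (\<chi> ^ m) m + fps_nth (fps_deriv \<psi> * \<chi> ^ Suc m) k) = 0"
      by (simp add: Suc algebra_simps del: power_Suc)
    moreover have "of_nat m \<noteq> (0::'a)" unfolding of_nat_eq_0_iff using Suc by simp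
    ultimately have "fps_nth (\<chi> ^ m) m + fps_nth (fps_deriv \<psi> * \<chi> ^ Suc m) k = 0"
      by (metis mult_eq_0_iff)
    then show ?thesis unfolding e using Suc by (simp del: power_Suc)
  qed
  define R where "R = fps_deriv t * \<chi> ^ Suc n"
  have pick: "fps_nth (t ^ i * R) n = (if i = n then 1 else 0)" if "i \<le> n" for i
  proof -
    have "\<psi> ^ i * \<chi> ^ i = 1" by (simp add: inv flip: power_mult_distrib)
    moreover have "\<chi> ^ Suc n = \<chi> ^ i * \<chi> ^ Suc (n - i)"
      using that by (simp flip: power_add)
    ultimately have "t ^ i * R = fps_X ^ i * (fps_deriv t * \<chi> ^ Suc (n - i))"
      by (simp add: R_def t_def power_mult_distrib mult_ac del: power_Suc)
    then show ?thesis using that key[of "n - i"]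
      by (simp add: fps_X_power_mult_nth del: power_Suc)
  qed
  have trunc: "fps_nth (g oo t) j = fps_nth (\<Sum>i\<le>n. fps_const (fps_nth g i) * t ^ i) j"
    if "j \<le> n" for j
  proof -
    have "fps_nth (t ^ i) j = 0" if "j < i" for i
      using that by (simp add: t_def power_mult_distrib fps_X_power_mult_nth)
    then show ?thesis using that
      unfolding fps_compose_nth fps_sum_nth fps_mult_left_const_nth
      by (intro sum.mono_neutral_left) auto
  qed
  have "fps_nth ((g oo t) * R) n = fps_nth ((\<Sum>i\<le>n. fps_const (fps_nth g i) * t ^ i) * R) n"
    unfolding fps_mult_nth by (intro sum.cong) (simp_all add: trunc)
  also have "\<dots> = (\<Sum>i\<le>n. fps_nth g i * fps_nth (t ^ i * R) n)"
    by (simp add: sum_distrib_right fps_sum_nth mult.assoc)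
  also have "\<dots> = (\<Sum>i\<le>n. if i = n then fps_nth g i else 0)"
    by (intro sum.cong) (simp_all add: pick)
  finally show ?thesis by (simp add: R_def mult.assoc)
qed

lemma fps_nth_geometric_power:
  fixes V :: "'a :: field_char_0 fps"
  assumes V: "(1 - fps_X) * V = 1"
  shows "fps_nth (V ^ Suc m) n = of_nat ((m + n) choose n)"
proof (induction m arbitrary: n)
  case 0
  have r: "V = 1 + fps_X * V" using V by (simp add: algebra_simps)
  have "fps_nth V n = 1"
  proof (induction n)
    case 0 show ?case by (subst r) simp
  next
    case (Suc n) then show ?case by (subst r) simp
  qed
  then show ?case by simp
next
  case (Suc m)
  note outer = Suc
  have "V = 1 + fps_X * V" using V by (simp add: algebra_simps)
  then have "V ^ Suc (Suc m) = (1 + fps_X * V) * V ^ Suc m" by (metis power_Suc)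
  then have r: "V ^ Suc (Suc m) = V ^ Suc m + fps_X * V ^ Suc (Suc m)"
    by (simp add: algebra_simps)
  show ?case
  proof (induction n)
    case 0
    show ?case using Suc[of 0] by (subst r) (simp del: power_Suc)
  next
    case (Suc n')
    show ?case using Suc outer[of "Suc n'"]
      by (subst r) (simp del: power_Suc)
  qed
qed

section \<open>Systems with a catalytic variable\<close>

text \<open>The coefficientwise form, in powers of the catalytic variable \<open>x\<close>, of the equation
  \<open>F = 1 + x * \<tau> * F * (x * F - F(1)) / (x - 1)\<close> with \<open>F = (\<Sum>k. G k * x ^ k)\<close>. The series \<open>H r\<close> is the tail
  \<open>\<Sum>k\<ge>r. G k\<close>, in particular \<open>H 0 = F(1)\<close>; the last two conditions say this without infinite
  sums.\<close>

definition catalytic_system ::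
    "'a :: comm_ring_1 fps \<Rightarrow> (nat \<Rightarrow> 'a fps) \<Rightarrow> (nat \<Rightarrow> 'a fps) \<Rightarrow> bool" where
  "catalytic_system \<tau> G H \<longleftrightarrow>
     G 0 = 1 \<and> (\<forall>k. G (Suc k) = \<tau> * (\<Sum>j\<le>k. G j * H (k - j))) \<and>
     (\<forall>r. H r = G r + H (Suc r)) \<and> (\<forall>r. fps_X ^ r dvd H r)"

lemma catalytic_systemD:
  assumes "catalytic_system \<tau> G H"
  shows "G 0 = 1" "G (Suc k) = \<tau> * (\<Sum>j\<le>k. G j * H (k - j))"
    "H r = G r + H (Suc r)" "fps_X ^ r dvd H r"
  using assms unfolding catalytic_system_def by blast+

lemma nth_eq_0_if_fps_X_power_dvd:
  fixes f :: "'a :: comm_ring_1 fps"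
  assumes "fps_X ^ r dvd f" "n < r"
  shows "fps_nth f n = 0"
  using assms by (auto simp: dvd_def fps_X_power_mult_nth)

text \<open>Since \<open>\<tau>\<close> has no constant term, each \<open>G k\<close> is determined to the next order by what is known
  of all the series; each \<open>H r\<close> then follows by descending from an \<open>r\<close> beyond this order, where
  \<open>H r\<close> vanishes.\<close>

lemma catalytic_system_unique:
  assumes GH: "catalytic_system \<tau> G H" and GH': "catalytic_system \<tau> G' H'"
    and \<tau>: "fps_nth \<tau> 0 = 0"
  shows "H r = H' r"
proof -
  have "\<forall>k. fps_nth (G k) n = fps_nth (G' k) n \<and> fps_nth (H k) n = fps_nth (H' k) n" for n
  proof (induction n rule: less_induct)
    case (less n)
    have G: "fps_nth (G k) n = fps_nth (G' k) n" for k
    proof (cases k)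
      case 0
      then show ?thesis by (simp add: catalytic_systemD(1)[OF GH] catalytic_systemD(1)[OF GH'])
    next
      case (Suc k')
      have eq: "fps_nth (\<Sum>j\<le>k'. G j * H (k' - j)) i = fps_nth (\<Sum>j\<le>k'. G' j * H' (k' - j)) i"
        if "i < n" for i
        unfolding fps_sum_nth fps_mult_nth
      proof (intro sum.cong refl)
        fix j l assume "l \<in> {0..i}"
        then have "l < n" "i - l < n" using that by auto
        then show "fps_nth (G j) l * fps_nth (H (k' - j)) (i - l)
            = fps_nth (G' j) l * fps_nth (H' (k' - j)) (i - l)"
          using less.IH[of l] less.IH[of "i - l"] by simp
      qed
      have "fps_nth (\<tau> * (\<Sum>j\<le>k'. G j * H (k' - j))) n
          = fps_nth (\<tau> * (\<Sum>j\<le>k'. G' j * H' (k' - j))) n"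
        unfolding fps_mult_nth[of \<tau>]
      proof (rule sum.cong)
        fix i assume "i \<in> {0..n}"
        then have "i = 0 \<or> n - i < n" by auto
        then have "fps_nth \<tau> i = 0 \<or> fps_nth (\<Sum>j\<le>k'. G j * H (k' - j)) (n - i)
          = fps_nth (\<Sum>j\<le>k'. G' j * H' (k' - j)) (n - i)"
          using \<tau> eq by blast
        then show "fps_nth \<tau> i * fps_nth (\<Sum>j\<le>k'. G j * H (k' - j)) (n - i)
          = fps_nth \<tau> i * fps_nth (\<Sum>j\<le>k'. G' j * H' (k' - j)) (n - i)"
          by (elim disjE) (simp_all only: mult_zero_left)
      qed simp
      then show ?thesis
        unfolding Suc catalytic_systemD(2)[OF GH] catalytic_systemD(2)[OF GH'] .
    qed
    have large: "fps_nth (H k) n = fps_nth (H' k) n" if "n < k" for k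
      using nth_eq_0_if_fps_X_power_dvd[OF catalytic_systemD(4)[OF GH] that]
        nth_eq_0_if_fps_X_power_dvd[OF catalytic_systemD(4)[OF GH'] that] by simp
    have "fps_nth (H k) n = fps_nth (H' k) n" for k
    proof (cases "k \<le> Suc n")
      case True
      then show ?thesis
      proof (induction k rule: inc_induct)
        case base
        then show ?case by (simp add: large)
      next
        case (step k)
        show ?case
          unfolding catalytic_systemD(3)[OF GH, of k] catalytic_systemD(3)[OF GH', of k]
          using step.IH G by simp
      qed
    qed (simp add: large)
    with G show ?case by blast
  qed
  then show ?thesis by (simp add: fps_eq_iff)
qed

lemma catalytic_system_compose:
  fixes t :: "'a :: idom fps"
  assumes GH: "catalytic_system \<tau> G H" and t: "fps_nth t 0 = 0"
  shows "catalytic_system (\<tau> oo t) (\<lambda>k. G k oo t) (\<lambda>k. H k oo t)"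
proof -
  have "fps_X ^ r dvd (H r oo t)" for r
  proof -
    obtain K where "H r = fps_X ^ r * K"
      using catalytic_systemD(4)[OF GH] by (meson dvdE)
    then have "H r oo t = t ^ r * (K oo t)"
      using t by (simp add: fps_compose_mult_distrib fps_compose_power[symmetric])
    moreover have "t = fps_X * fps_shift 1 t"
      using t by (intro fps_ext) (auto simp: )
    then have "fps_X dvd t" by (rule dvdI)
    ultimately show ?thesis by (simp add: dvd_mult2 dvd_power_same)
  qed
  moreover have "H r oo t = (G r oo t) + (H (Suc r) oo t)" for r
    by (subst catalytic_systemD(3)[OF GH]) (rule fps_compose_add_distrib)
  moreover have "G (Suc k) oo t = (\<tau> oo t) * (\<Sum>j\<le>k. (G j oo t) * (H (k - j) oo t))" for k
    unfolding catalytic_systemD(2)[OF GH]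
    by (simp add: fps_compose_mult_distrib[OF t] fps_compose_sum_distrib)
  moreover have "G 0 oo t = 1"
    by (simp add: catalytic_systemD(1)[OF GH])
  ultimately show ?thesis
    unfolding catalytic_system_def by blast
qed

definition intervals_spine_eq_fps :: "nat \<Rightarrow> real fps" where
  "intervals_spine_eq_fps k = Abs_fps (\<lambda>n. real (card (intervals_spine_eq n k)))"

definition intervals_spine_ge_fps :: "nat \<Rightarrow> real fps" where
  "intervals_spine_ge_fps k = Abs_fps (\<lambda>n. real (card (intervals_spine_ge n k)))"

lemma catalytic_system_intervals:
  "catalytic_system fps_X intervals_spine_eq_fps intervals_spine_ge_fps"
proof -
  have "intervals_spine_eq_fps 0 = 1"
  proof (rule fps_ext)
    fix n show "fps_nth (intervals_spine_eq_fps 0) n = fps_nth 1 n"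
      by (cases n) (simp_all add: intervals_spine_eq_fps_def card_intervals_spine_eq_0_left
          card_intervals_spine_eq_0_right)
  qed
  moreover have "intervals_spine_eq_fps (Suc k)
    = fps_X * (\<Sum>j\<le>k. intervals_spine_eq_fps j * intervals_spine_ge_fps (k - j))" for k
  proof (rule fps_ext)
    fix n show "fps_nth (intervals_spine_eq_fps (Suc k)) n
      = fps_nth (fps_X * (\<Sum>j\<le>k. intervals_spine_eq_fps j * intervals_spine_ge_fps (k - j))) n"
    proof (cases n)
      case 0
      then show ?thesis by (simp add: intervals_spine_eq_fps_def card_intervals_spine_eq_0_left)
    next
      case (Suc m)
      have "real (card (intervals_spine_eq (Suc m) (Suc k))) = (\<Sum>j\<le>k. \<Sum>i\<le>m.
          real (card (intervals_spine_eq i j)) * real (card (intervals_spine_ge (m - i) (k - j))))"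
        unfolding card_intervals_spine_eq_Suc by (subst sum.swap) simp
      moreover have "fps_nth (\<Sum>j\<le>k. intervals_spine_eq_fps j * intervals_spine_ge_fps (k - j)) m
        = (\<Sum>j\<le>k. \<Sum>i\<le>m.
          real (card (intervals_spine_eq i j)) * real (card (intervals_spine_ge (m - i) (k - j))))"
        by (simp add: intervals_spine_eq_fps_def intervals_spine_ge_fps_def fps_sum_nth fps_mult_nth
            atLeast0AtMost)
      ultimately show ?thesis using Suc by (simp add: intervals_spine_eq_fps_def)
    qed
  qed
  moreover have "intervals_spine_ge_fps r = intervals_spine_eq_fps r + intervals_spine_ge_fps (Suc r)" for r
    by (rule fps_ext)
      (simp add: intervals_spine_eq_fps_def intervals_spine_ge_fps_def card_intervals_spine_ge_step[of _ r])
  moreover have "fps_X ^ r dvd intervals_spine_ge_fps r" for r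
  proof
    show "intervals_spine_ge_fps r = fps_X ^ r * fps_shift r (intervals_spine_ge_fps r)"
      by (rule fps_ext)
        (simp add: fps_X_power_mult_nth intervals_spine_ge_fps_def card_intervals_spine_ge_large)
  qed
  ultimately show ?thesis unfolding catalytic_system_def by blast
qed

section \<open>The parametrized solution\<close>

text \<open>The functional equation of the problem is quadratic in the unknown series; after the
  substitution \<open>t = z * (1 - z)^3\<close> its discriminant becomes
  \<open>(1 - (1 - z) * x)\<^sup>2 * (1 - 4 * x * z * (1 - z))\<close>, so that it is solved in terms of the Catalan
  series \<open>A\<close> at \<open>x * z * (1 - z)\<close>. Here \<open>p\<close> is \<open>1 - z\<close> times the solution, and the identity is the
  functional equation with denominators cleared.\<close>

lemma parametrized_identity:
  fixes A x z :: "'a :: comm_ring_1"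
  assumes A: "A = 1 + x * (z * (1 - z)) * A\<^sup>2"
    and p: "p = A - z * A\<^sup>2"
  shows "(1 - x) * (p - (1 - z)) = x * z * p * ((1 - 2 * z) - x * (1 - z)\<^sup>2 * p)"
proof -
  have h: "A - 1 = x * z * (1 - z) * A\<^sup>2" using A by (simp add: algebra_simps)
  have "x * z * p * (x * (1 - z)\<^sup>2 * p) = x * (1 - z) * (x * z * (1 - z) * A\<^sup>2) * (1 - 2 * z * A)
    + z * (x * z * (1 - z) * A\<^sup>2)\<^sup>2"
    unfolding p by (simp add: power2_eq_square algebra_simps)
  also have "\<dots> = x * (1 - z) * (A - 1) * (1 - 2 * z * A) + z * (A - 1)\<^sup>2"
    by (simp only: h)
  finally have e: "x * z * p * (x * (1 - z)\<^sup>2 * p) =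
    x * (1 - z) * (A - 1) * (1 - 2 * z * A) + z * (A - 1)\<^sup>2" .
  have "(1 - x) * (p - (1 - z)) - x * z * p * (1 - 2 * z)
      + (x * (1 - z) * (A - 1) * (1 - 2 * z * A) + z * (A - 1)\<^sup>2)
      = (1 - 2 * z) * (A - 1 - x * z * (1 - z) * A\<^sup>2)"
    unfolding p by (simp add: power2_eq_square algebra_simps)
  also have "\<dots> = 0" by (simp add: h)
  finally show ?thesis unfolding e[symmetric] by (simp add: algebra_simps)
qed

text \<open>The \<open>n\<close>-th Catalan number times \<open>(z * (1 - z)) ^ n\<close>, where \<open>z = fps_X\<close>: the coefficient of
  \<open>x ^ n\<close> in the Catalan series at \<open>x * z * (1 - z)\<close>.\<close>

fun catalan_term :: "nat \<Rightarrow> real fps" where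
  "catalan_term 0 = 1"
| "catalan_term (Suc n) =
    fps_X * (1 - fps_X) * (\<Sum>i\<le>n. catalan_term i * catalan_term (n - i))"

lemma fps_X_power_dvd_convolution:
  fixes f g :: "nat \<Rightarrow> 'a :: comm_ring_1 fps"
  assumes "\<And>i. i \<le> k \<Longrightarrow> fps_X ^ i dvd f i" "\<And>i. i \<le> k \<Longrightarrow> fps_X ^ i dvd g i"
  shows "fps_X ^ k dvd (\<Sum>i\<le>k. f i * g (k - i))"
proof (rule dvd_sum)
  fix i assume "i \<in> {..k}"
  then have "fps_X ^ i * fps_X ^ (k - i) dvd f i * g (k - i)"
    using assms by (intro mult_dvd_mono) auto
  then show "fps_X ^ k dvd f i * g (k - i)"
    using \<open>i \<in> {..k}\<close> by (simp flip: power_add)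
qed

lemma fps_X_power_dvd_catalan_term: "fps_X ^ k dvd catalan_term k"
proof (induction k rule: less_induct)
  case (less k)
  show ?case
  proof (cases k)
    case (Suc n)
    have "fps_X ^ n dvd (\<Sum>i\<le>n. catalan_term i * catalan_term (n - i))"
      using less Suc by (intro fps_X_power_dvd_convolution) auto
    then have "fps_X * fps_X ^ n dvd
        fps_X * ((1 - fps_X) * (\<Sum>i\<le>n. catalan_term i * catalan_term (n - i)))"
      by (intro mult_dvd_mono dvd_mult dvd_refl)
    then show ?thesis using Suc by (simp add: mult.assoc)
  qed simp
qed

definition geo :: "real fps" where
  "geo = inverse (1 - fps_X)"

lemma geo: "(1 - fps_X) * geo = 1"
  unfolding geo_def by (rule inverse_mult_eq_1') simp

text \<open>The coefficient of \<open>x ^ k\<close> in the solution \<open>(A - z * A\<^sup>2) / (1 - z)\<close>, with \<open>A\<close> as in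
  \<open>parametrized_identity\<close>.\<close>

definition param_eq :: "nat \<Rightarrow> real fps" where
  "param_eq k = geo * (catalan_term k
     - fps_X * (\<Sum>i\<le>k. catalan_term i * catalan_term (k - i)))"

text \<open>The tails of the series with terms \<open>param_eq k\<close>. Their total is \<open>(1 - 2 * z) / (1 - z)^3\<close>,
  because \<open>A\<close> takes the value \<open>1 / (1 - z)\<close> at \<open>x = 1\<close>.\<close>

definition param_ge :: "nat \<Rightarrow> real fps" where
  "param_ge r = (1 - 2 * fps_X) * geo ^ 3 - (\<Sum>k<r. param_eq k)"

text \<open>The generating functions in \<open>x\<close> are handled as power series over the power series in \<open>z\<close>. There
  the tails satisfy \<open>(1 - x) * Q = Q\<^sub>0 - x * P\<close>, and \<open>1 - x\<close> can be cancelled at the end.\<close>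

lemma param_system:
  "param_eq 0 = 1 \<and>
   param_eq (Suc k) = fps_X * (1 - fps_X) ^ 3 * (\<Sum>j\<le>k. param_eq j * param_ge (k - j))"
proof -
  define A where "A = Abs_fps catalan_term"
  define x :: "real fps fps" where "x = fps_X"
  define z :: "real fps fps" where "z = fps_const fps_X"
  define v where "v = fps_const geo"
  define p where "p = A - z * A\<^sup>2"
  define P where "P = Abs_fps param_eq"
  define Q where "Q = Abs_fps param_ge"
  have one: "(1 :: real fps fps) = fps_const 1" and two: "(2 :: real fps fps) = fps_const 2"
    by (simp_all add: numeral_fps_const)
  have const_simps: "z * (1 - z) = fps_const (fps_X * (1 - fps_X))"
    "z * (1 - z) ^ 3 = fps_const (fps_X * (1 - fps_X) ^ 3)"
    "(1 - z) * v = fps_const ((1 - fps_X) * geo)"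
    "(1 - 2 * z) * v ^ 3 = fps_const ((1 - 2 * fps_X) * geo ^ 3)"
    unfolding z_def v_def one two fps_const_sub fps_const_mult fps_const_power by (rule refl)+
  have A: "A = 1 + x * (z * (1 - z)) * A\<^sup>2"
  proof (rule fps_ext)
    fix n
    have "fps_nth (x * (z * (1 - z)) * A\<^sup>2) (Suc m) = fps_nth A (Suc m)" for m
    proof -
      have "x * (z * (1 - z)) * A\<^sup>2 = fps_X * (fps_const (fps_X * (1 - fps_X)) * (A * A))"
        by (simp add: const_simps x_def power2_eq_square mult.assoc)
      moreover have "fps_nth (A * A) m = (\<Sum>i\<le>m. catalan_term i * catalan_term (m - i))"
        by (simp add: A_def fps_mult_nth atLeast0AtMost)
      ultimately show ?thesis by (simp add: A_def)
    qed
    then show "fps_nth A n = fps_nth (1 + x * (z * (1 - z)) * A\<^sup>2) n"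
      by (cases n) (simp_all add: A_def x_def)
  qed
  have wv: "(1 - z) * v = 1"
    by (simp add: const_simps geo)
  have P: "P = v * p"
  proof (rule fps_ext)
    fix n
    have "fps_nth (A * A) n = (\<Sum>i\<le>n. catalan_term i * catalan_term (n - i))"
      by (simp add: A_def fps_mult_nth atLeast0AtMost)
    then show "fps_nth P n = fps_nth (v * p) n"
      by (simp add: P_def param_eq_def v_def p_def z_def power2_eq_square) (simp add: A_def)
  qed
  have Q: "(1 - x) * Q = (1 - 2 * z) * v ^ 3 - x * P"
  proof (rule fps_ext)
    fix n
    show "fps_nth ((1 - x) * Q) n = fps_nth ((1 - 2 * z) * v ^ 3 - x * P) n"
      unfolding const_simps by (cases n) (simp_all add: Q_def x_def P_def param_ge_def left_diff_distrib)
  qed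
  have "(1 - x) * (P - 1 - x * (z * (1 - z) ^ 3) * (P * Q)) =
     (1 - x) * (P - 1) - x * (z * (1 - z) ^ 3) * P * ((1 - x) * Q)"
    by (simp add: algebra_simps)
  also have "\<dots> = v * ((1 - x) * (p - (1 - z)) - x * z * p * ((1 - 2 * z) - x * (1 - z)\<^sup>2 * p))"
  proof -
    have 1: "P - 1 = v * (p - (1 - z))" unfolding P using wv by (simp add: algebra_simps)
    have "(1 - z) ^ 3 * ((1 - x) * Q) = (1 - 2 * z) * ((1 - z) * v) ^ 3 - ((1 - z) * v) * (x * (1 - z)\<^sup>2 * p)"
      unfolding Q P by (simp only: power_mult_distrib) (simp add: power2_eq_square power3_eq_cube algebra_simps)
    then have 2: "(1 - z) ^ 3 * ((1 - x) * Q) = (1 - 2 * z) - x * (1 - z)\<^sup>2 * p"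
      unfolding wv by simp
    have "x * (z * (1 - z) ^ 3) * P * ((1 - x) * Q) = x * z * P * ((1 - z) ^ 3 * ((1 - x) * Q))"
      by (simp only: mult_ac)
    then show ?thesis unfolding 1 2 unfolding P by (simp add: algebra_simps)
  qed
  also have "\<dots> = 0" using parametrized_identity[OF A p_def] by simp
  finally have "(1 - x) * (P - 1 - x * (z * (1 - z) ^ 3) * (P * Q)) = 0" .
  moreover have "1 - x \<noteq> 0"
  proof
    assume "1 - x = 0"
    then have "fps_nth (1 - x) 0 = 0" by simp
    then show False by (simp add: x_def)
  qed
  ultimately have "P - 1 - x * (z * (1 - z) ^ 3) * (P * Q) = 0"
    by (metis mult_eq_0_iff)
  then have eq: "P = 1 + x * (z * (1 - z) ^ 3) * (P * Q)"
    by (simp add: diff_diff_eq)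
  have "fps_nth P 0 = 1" by (subst eq) (simp add: x_def)
  moreover have "fps_nth P (Suc k) = fps_X * (1 - fps_X) ^ 3 * fps_nth (P * Q) k"
    by (subst eq) (simp add: const_simps x_def mult.assoc)
  ultimately show ?thesis
    by (simp add: P_def Q_def fps_mult_nth atLeast0AtMost)
qed

lemma fps_X_power_dvd_param_eq: "fps_X ^ k dvd param_eq k"
  unfolding param_eq_def
  by (intro dvd_mult dvd_diff fps_X_power_dvd_catalan_term fps_X_power_dvd_convolution)

text \<open>Rather than summing the tail, solve the recursion \<open>param_system\<close> for \<open>param_ge r\<close>: it
  expresses \<open>fps_X * param_ge r\<close> by terms that visibly have order at least \<open>r + 1\<close>.\<close>

lemma fps_X_power_dvd_param_ge: "fps_X ^ r dvd param_ge r"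
proof (induction r rule: less_induct)
  case (less r)
  let ?S = "\<Sum>j<r. param_eq (Suc j) * param_ge (r - Suc j)"
  have "(\<Sum>j\<le>r. param_eq j * param_ge (r - j)) = param_ge r + ?S"
    by (simp add: sum.atMost_shift conjunct1[OF param_system])
  then have "geo ^ 3 * param_eq (Suc r) = ((1 - fps_X) * geo) ^ 3 * (fps_X * (param_ge r + ?S))"
    unfolding conjunct2[OF param_system] by (simp only: power_mult_distrib mult_ac)
  then have *: "fps_X * param_ge r = geo ^ 3 * param_eq (Suc r) - fps_X * ?S"
    unfolding geo by (simp add: algebra_simps)
  have "fps_X ^ Suc r dvd fps_X * (param_eq (Suc j) * param_ge (r - Suc j))" if "j < r" for j
  proof -
    have "fps_X ^ Suc j * fps_X ^ (r - Suc j) dvd param_eq (Suc j) * param_ge (r - Suc j)"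
      using that by (intro mult_dvd_mono less fps_X_power_dvd_param_eq) auto
    moreover have "fps_X ^ Suc j * fps_X ^ (r - Suc j) = (fps_X :: real fps) ^ r"
      using that by (simp only: power_add[symmetric]) simp
    ultimately show ?thesis by (simp add: mult_dvd_mono)
  qed
  then have "fps_X ^ Suc r dvd fps_X * ?S"
    unfolding sum_distrib_left by (intro dvd_sum) auto
  then have "fps_X ^ Suc r dvd fps_X * param_ge r"
    unfolding * by (rule dvd_diff[OF dvd_mult[OF fps_X_power_dvd_param_eq]])
  then show ?case by simp
qed

lemma catalytic_system_param:
  "catalytic_system (fps_X * (1 - fps_X) ^ 3) param_eq param_ge"
proof -
  have "param_ge r = param_eq r + param_ge (Suc r)" for r
    by (simp add: param_ge_def)
  then show ?thesis
    using param_system fps_X_power_dvd_param_ge unfolding catalytic_system_def by blast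
qed

lemma intervals_series_param:
  "intervals_spine_ge_fps 0 oo (fps_X * (1 - fps_X) ^ 3) = (1 - 2 * fps_X) * geo ^ 3"
proof -
  let ?t = "fps_X * (1 - fps_X) ^ 3 :: real fps"
  have "catalytic_system (fps_X oo ?t) (\<lambda>k. intervals_spine_eq_fps k oo ?t) (\<lambda>k. intervals_spine_ge_fps k oo ?t)"
    by (intro catalytic_system_compose catalytic_system_intervals) simp
  then have "catalytic_system ?t (\<lambda>k. intervals_spine_eq_fps k oo ?t) (\<lambda>k. intervals_spine_ge_fps k oo ?t)"
    by simp
  from catalytic_system_unique[OF this catalytic_system_param, of 0] show ?thesis
    by (simp add: param_ge_def)
qed

theorem mainTheorem1:
  fixes n :: nat
  assumes "n \<ge> 1"
  shows "real (card (tamari_intervals n))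
    = 2 * fact (4 * n + 1) / (fact (n + 1) * fact (3 * n + 2))"
proof -
  let ?t = "fps_X * (1 - fps_X) ^ 3 :: real fps"
  define W where "W = geo ^ Suc (3 * n + 3)"
  have W: "fps_nth W j = real ((3 * n + 3 + j) choose j)" for j
    unfolding W_def by (rule fps_nth_geometric_power[OF geo])
  \<comment> \<open>Since \<open>t' = (1 - z)^2 * (1 - 4 * z)\<close>, the change of variables turns the number of
    intervals into the coefficient of \<open>z ^ n\<close> in
    \<open>(1 - 2 * z) * (1 - 4 * z) / (1 - z)^(3 * n + 4)\<close>.\<close>
  have deriv: "fps_deriv ?t = (1 - fps_X)\<^sup>2 * (1 - 4 * fps_X)"
    by (simp add: fps_deriv_power' power2_eq_square power3_eq_cube algebra_simps)
  have powers: "geo ^ 3 * (1 - fps_X)\<^sup>2 * (geo ^ 3) ^ Suc n = W"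
  proof -
    have "geo ^ 3 * (1 - fps_X)\<^sup>2 * (geo ^ 3) ^ Suc n
        = ((1 - fps_X) * geo)\<^sup>2 * (geo * (geo ^ 3) ^ Suc n)"
      by (simp only: power2_eq_square power3_eq_cube mult_ac)
    also have "\<dots> = W"
      unfolding geo W_def power_mult[symmetric] by (simp flip: power_Suc)
    finally show ?thesis .
  qed
  have "(1 - 2 * fps_X) * geo ^ 3 * fps_deriv ?t * (geo ^ 3) ^ Suc n
      = (1 - 2 * fps_X) * (1 - 4 * fps_X) * (geo ^ 3 * (1 - fps_X)\<^sup>2 * (geo ^ 3) ^ Suc n)"
    unfolding deriv by (simp only: mult_ac)
  also have "\<dots> = W - 6 * (fps_X * W) + 8 * (fps_X\<^sup>2 * W)"
    unfolding powers by (simp add: algebra_simps power2_eq_square)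
  also have "\<dots> = W - fps_const 6 * (fps_X * W) + fps_const 8 * (fps_X\<^sup>2 * W)"
    by (simp only: numeral_fps_const)
  finally have "(1 - 2 * fps_X) * geo ^ 3 * fps_deriv ?t * (geo ^ 3) ^ Suc n
      = W - fps_const 6 * (fps_X * W) + fps_const 8 * (fps_X\<^sup>2 * W)" .
  moreover have "(1 - fps_X) ^ 3 * geo ^ 3 = 1"
    using geo by (simp flip: power_mult_distrib)
  ultimately have "fps_nth (intervals_spine_ge_fps 0) n
      = fps_nth (W - fps_const 6 * (fps_X * W) + fps_const 8 * (fps_X\<^sup>2 * W)) n"
    using fps_lagrange_change_of_variable[of "(1 - fps_X) ^ 3" "geo ^ 3" "intervals_spine_ge_fps 0" n]
    by (simp only: intervals_series_param)
  then have card: "real (card (tamari_intervals n))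
      = fps_nth W n - 6 * fps_nth W (n - 1) + (if n < 2 then 0 else 8 * fps_nth W (n - 2))"
    using assms by (simp add: intervals_spine_ge_fps_def intervals_spine_ge_0 fps_X_power_mult_nth)
  show ?thesis
  proof (cases "n = 1")
    case True
    then show ?thesis unfolding card W by (simp add: fact_numeral)
  next
    case False
    then obtain m where n: "n = m + 2" using assms
      by (intro that[of "n - 2"]) simp
    have f: "fact (4 * m + 11) = (4 * real m + 11) * ((4 * real m + 10) * fact (4 * m + 9))"
      "fact (4 * m + 10) = (4 * real m + 10) * fact (4 * m + 9)"
      "fact (3 * m + 9) = 3 * (real m + 3) * fact (3 * m + 8)"
      "fact (m + 3) = (real m + 3) * ((real m + 2) * ((real m + 1) * fact m))"
      "fact (m + 2) = (real m + 2) * ((real m + 1) * fact m)"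
      "fact (m + 1) = (real m + 1) * fact m"
      by (simp_all add: eval_nat_numeral algebra_simps)
    have "real (card (tamari_intervals n)) = fact (4 * m + 11) / (fact (m + 2) * fact (3 * m + 9))
        - 6 * (fact (4 * m + 10) / (fact (m + 1) * fact (3 * m + 9)))
        + 8 * (fact (4 * m + 9) / (fact m * fact (3 * m + 9)))"
    proof -
      have "3 * n + 3 + n = 4 * m + 11" "3 * n + 3 + (n - 1) = 4 * m + 10"
        "3 * n + 3 + (n - 2) = 4 * m + 9" "n - 1 = m + 1" "n - 2 = m" "\<not> n < 2"
        using n by auto
      moreover have "4 * m + 11 - (m + 2) = 3 * m + 9" "4 * m + 10 - (m + 1) = 3 * m + 9"
        "4 * m + 9 - m = 3 * m + 9"
        by auto
      ultimately show ?thesis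
        using binomial_fact[of "m + 2" "4 * m + 11", where 'a = real]
          binomial_fact[of "m + 1" "4 * m + 10", where 'a = real]
          binomial_fact[of m "4 * m + 9", where 'a = real]
        unfolding card W using n by (simp only: if_False)
    qed
    also have "\<dots> = 2 * fact (4 * m + 9) / (fact (m + 3) * fact (3 * m + 8))"
    proof -
      have common: "X * (Y * a) / (v * (u * b) * (3 * w * c)) - 6 * (Y * a / (u * b * (3 * w * c)))
          + 8 * (a / (b * (3 * w * c))) = (X * Y - 6 * v * Y + 8 * u * v) / 3 * a / (w * (v * (u * b)) * c)"
        if "u \<noteq> 0" "v \<noteq> 0" "w \<noteq> 0" "b \<noteq> 0" "c \<noteq> 0" for X Y a b c u v w :: real
        using that by (simp add: field_simps)
      have "(4 * real m + 11) * (4 * real m + 10) - 6 * (real m + 2) * (4 * real m + 10)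
          + 8 * (real m + 1) * (real m + 2) = 6"
        by (simp add: algebra_simps)
      moreover have "real m + 1 \<noteq> 0" "real m + 2 \<noteq> 0" "real m + 3 \<noteq> 0"
        by linarith+
      ultimately show ?thesis unfolding f by (subst common) simp_all
    qed
    also have "m + 3 = n + 1" using n by simp
    also have "3 * m + 8 = 3 * n + 2" using n by simp
    also have "4 * m + 9 = 4 * n + 1" using n by simp
    finally show ?thesis .
  qed
qed

end
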